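(* Let $G$ be an $\ell$-group (lattice-ordered group, not necessarily abelian). Then the following statements are equivalent. (1) $\mathbf{C}(G)$ is disjunctive. (2) $G\in(\mathrm{M})$, that is, $\mathfrak{C}(G)$ is a Martínez frame. (3) $\mathrm{Spec}_d(G)=\mathrm{Spec}(G)$. (4) For all $a\in G$, $G(a)=a^{\perp\perp}$. (5) For all $a\in G$, $G(a)$ is a $d$-element of $\mathfrak{C}(G)$. (6) The set $\mathrm{Min}(G)$ is dense in $\mathrm{Spec}(G)$ with respect to the patch topology. (7) The set $\{U(a):0<a\in G\}$ is a $\pi$-base for the patch topology on $\mathrm{Spec}(G)$. (8) Distinct compact open subsets of $\mathrm{Spec}(G)$ have distinct closures (with respect to the hull-kernel topology). (9) For every $a\in G$, $G(a)\in(\mathrm{M})$. (10) For every $H\in\mathfrak{C}(G)$, $H\in(\mathrm{M})$. (11) For all $a\in G$, $G(a)=\bigcap\{p\in\mathrm{Min}(G):a\in p\}$. (12) For all $a,b\in G$, $G(a)=G(b)$ if and only if $a^{\perp\perp}=b^{\perp\perp}$.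
   Context: For an $\ell$-group $G$ (written additively), $\mathfrak{C}(G)$ is the lattice of all convex $\ell$-subgroups of $G$ ordered by inclusion; it is an algebraic frame in which the meet of two compact elements is compact. For $a\in G$, $G(a)=\{b\in G:|b|\le n|a|\text{ for some }n\in\mathbb{N}\}$ is the principal convex $\ell$-subgroup generated by $a$; $\mathbf{C}(G)$ is the set of all $G(a)$ ordered by inclusion, a sublattice of $\mathfrak{C}(G)$ consisting of its compact elements, and a distributive lattice with least element $\{0\}$. A distributive lattice $L$ with $0$ is disjunctive if for all $a\nleq b$ in $L$ there is $c\in L$ with $a\wedge c>0$ and $b\wedge c=0$. For $S\subseteq G$, $S^\perp=\{h\in G:|h|\wedge|s|=0\text{ for all }s\in S\}$, and $a^\perp=\{a\}^\perp$. A convex $\ell$-subgroup $H$ is a $d$-element of $\mathfrak{C}(G)$ (a $d$-subgroup) if $a^{\perp\perp}\subseteq H$ for every $a\in H$. $\mathfrak{C}(G)$ is a Martínez frame if each of its elements is a $d$-element, and then one writes $G\in(\mathrm{M})$. $\mathrm{Spec}(G)$ is the set of proper prime subgroups of $G$ (proper convex $\ell$-subgroups $p$ such that $a\wedge b=0$ implies $a\in p$ or $b\in p$), $\mathrm{Spec}_d(G)$ is the set of those that are $d$-subgroups, and $\mathrm{Min}(G)$ is the set of minimal prime subgroups. For $a\in G$, $U(a)=\{p\in\mathrm{Spec}(G):a\notin p\}$ and $V(a)=\{p\in\mathrm{Spec}(G):a\in p\}$. The hull-kernel topology on $\mathrm{Spec}(G)$ has base $\{U(a):a\in G\}$; the patch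 topology has base $\{U(a)\cap V(b):a,b\in G\}$. A $\pi$-base is a family of nonempty open sets such that every nonempty open set contains a member of the family. An empty intersection of subgroups is $G$. *)

theory Defs
  imports "HOL-Analysis.Analysis"
begin

text \<open>Lattice-ordered groups, written additively but not assumed abelian.\<close>

class lgroup_add = group_add + lattice +
  assumes lgroup_add_left_mono: "a \<le> b \<Longrightarrow> c + a \<le> c + b"
    and lgroup_add_right_mono: "a \<le> b \<Longrightarrow> a + c \<le> b + c"

definition lg_abs :: "'a::lgroup_add \<Rightarrow> 'a" where
  "lg_abs a = sup a (- a)"

text \<open>
  All notions below are relative to a carrier \<open>G\<close>, a set closed under the \<open>\<ell>\<close>-group operations of
  the type and regarded as an \<open>\<ell>\<close>-group with the restricted operations and order.
  The \<open>\<ell>\<close>-group given by the type itself is \<open>UNIV\<close>; a convex \<open>\<ell>\<close>-subgroup becomes an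
  \<open>\<ell>\<close>-group in its own right by taking it as the carrier.
\<close>

definition convex_lsubgroups :: "'a::lgroup_add set \<Rightarrow> 'a set set" where
  "convex_lsubgroups G = {H. H \<subseteq> G \<and> 0 \<in> H \<and> (\<forall>x\<in>H. - x \<in> H) \<and>
     (\<forall>x\<in>H. \<forall>y\<in>H. x + y \<in> H \<and> inf x y \<in> H \<and> sup x y \<in> H) \<and>
     (\<forall>x\<in>H. \<forall>y\<in>H. \<forall>z\<in>G. x \<le> z \<and> z \<le> y \<longrightarrow> z \<in> H)}"

text \<open>\<open>((+) x ^^ n) 0\<close> is the multiple \<open>n x\<close>.\<close>

definition principal_lsubgroup :: "'a::lgroup_add set \<Rightarrow> 'a \<Rightarrow> 'a set" where
  "principal_lsubgroup G a = {b \<in> G. \<exists>n. lg_abs b \<le> ((+) (lg_abs a) ^^ n) 0}"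

definition principal_lsubgroups :: "'a::lgroup_add set \<Rightarrow> 'a set set" where
  "principal_lsubgroups G = principal_lsubgroup G ` G"

text \<open>
  A distributive lattice with least element is given here by its carrier, order, meet and least
  element.  For \<open>principal_lsubgroups G\<close>, a sublattice of \<open>convex_lsubgroups G\<close> under inclusion, these
  are \<open>(\<subseteq>)\<close>, \<open>(\<inter>)\<close> (as \<open>G(a) \<inter> G(b) = G(|a| \<and> |b|)\<close>) and \<open>{0}\<close>.  As \<open>zero\<close> is least,
  \<open>meet a c > zero\<close> amounts to \<open>meet a c \<noteq> zero\<close>.
\<close>

definition disjunctive ::
  "'b set \<Rightarrow> ('b \<Rightarrow> 'b \<Rightarrow> bool) \<Rightarrow> ('b \<Rightarrow> 'b \<Rightarrow> 'b) \<Rightarrow> 'b \<Rightarrow> bool" where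
  "disjunctive L le meet zero \<longleftrightarrow>
     (\<forall>a\<in>L. \<forall>b\<in>L. \<not> le a b \<longrightarrow> (\<exists>c\<in>L. meet a c \<noteq> zero \<and> meet b c = zero))"

definition perp :: "'a::lgroup_add set \<Rightarrow> 'a set \<Rightarrow> 'a set" where
  "perp G S = {h \<in> G. \<forall>s\<in>S. inf (lg_abs h) (lg_abs s) = 0}"

definition d_element :: "'a::lgroup_add set \<Rightarrow> 'a set \<Rightarrow> bool" where
  "d_element G H \<longleftrightarrow> H \<in> convex_lsubgroups G \<and> (\<forall>a\<in>H. perp G (perp G {a}) \<subseteq> H)"

definition martinez :: "'a::lgroup_add set \<Rightarrow> bool" where
  "martinez G \<longleftrightarrow> (\<forall>H\<in>convex_lsubgroups G. d_element G H)"

definition Spec :: "'a::lgroup_add set \<Rightarrow> 'a set set" where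
  "Spec G = {p \<in> convex_lsubgroups G. p \<noteq> G \<and>
     (\<forall>a\<in>G. \<forall>b\<in>G. inf a b = 0 \<longrightarrow> a \<in> p \<or> b \<in> p)}"

definition Spec_d :: "'a::lgroup_add set \<Rightarrow> 'a set set" where
  "Spec_d G = {p \<in> Spec G. d_element G p}"

definition Min_Spec :: "'a::lgroup_add set \<Rightarrow> 'a set set" where
  "Min_Spec G = {p \<in> Spec G. \<forall>q\<in>Spec G. q \<subseteq> p \<longrightarrow> q = p}"

definition Spec_U :: "'a::lgroup_add set \<Rightarrow> 'a \<Rightarrow> 'a set set" where
  "Spec_U G a = {p \<in> Spec G. a \<notin> p}"

definition Spec_V :: "'a::lgroup_add set \<Rightarrow> 'a \<Rightarrow> 'a set set" where
  "Spec_V G a = {p \<in> Spec G. a \<in> p}"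

text \<open>
  Both generating families are closed under finite intersections, as
  \<open>U(a) \<inter> U(b) = U(|a| \<and> |b|)\<close> and \<open>V(a) \<inter> V(b) = V(|a| \<or> |b|)\<close>, and they cover \<open>Spec G\<close>, as
  \<open>V(0) = Spec G\<close> and members of \<open>Spec G\<close> are proper; so they are bases of topologies on \<open>Spec G\<close>.
\<close>

definition hull_kernel_topology :: "'a::lgroup_add set \<Rightarrow> 'a set topology" where
  "hull_kernel_topology G = topology_generated_by {Spec_U G a | a. a \<in> G}"

definition patch_topology :: "'a::lgroup_add set \<Rightarrow> 'a set topology" where
  "patch_topology G = topology_generated_by {Spec_U G a \<inter> Spec_V G b | a b. a \<in> G \<and> b \<in> G}"

definition pi_base :: "'b topology \<Rightarrow> 'b set set \<Rightarrow> bool" where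
  "pi_base X B \<longleftrightarrow> (\<forall>W\<in>B. openin X W \<and> W \<noteq> {}) \<and>
     (\<forall>O'. openin X O' \<and> O' \<noteq> {} \<longrightarrow> (\<exists>W\<in>B. W \<subseteq> O'))"

definition all_equivalent :: "bool list \<Rightarrow> bool" where
  "all_equivalent Ps \<longleftrightarrow> (\<forall>P\<in>set Ps. \<forall>Q\<in>set Ps. P \<longleftrightarrow> Q)"

end

theory Submission
  imports Defs
begin

text \<open>
  Each statement is compared with (4), \<open>G(a) = a\<^sup>\<bottom>\<^sup>\<bottom>\<close> for all \<open>a\<close>.  By Zorn's lemma \<open>G(a)\<close> is the
  intersection of the primes containing \<open>a\<close>, and \<open>a\<^sup>\<bottom>\<^sup>\<bottom>\<close> that of the minimal primes
  containing \<open>a\<close>.  Hence \<open>U(a) \<inter> V(b)\<close> is nonempty iff \<open>a \<notin> G(b)\<close> and contains a minimal prime iff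
  \<open>a \<notin> b\<^sup>\<bottom>\<^sup>\<bottom>\<close>, which settles the statements about the patch topology.  In the hull-kernel topology
  the compact open sets are the \<open>U(a)\<close>; \<open>U(a)\<close> determines \<open>G(a)\<close> and its closure determines
  \<open>a\<^sup>\<bottom>\<close>.  Failure of \<open>h \<in> a\<^sup>\<bottom>\<^sup>\<bottom>\<close> is witnessed by some \<open>k \<bottom> a\<close> with \<open>\<bar>h\<bar> \<and> \<bar>k\<bar> \<noteq> 0\<close>, which
  gives disjunctivity and the \<open>\<pi>\<close>-base.
\<close>

section \<open>Arithmetic of lattice-ordered groups\<close>

lemma lg_add_le_cancel_left: "c + a \<le> c + b \<longleftrightarrow> a \<le> b" for a b c :: "'a::lgroup_add"
  using lgroup_add_left_mono[of a b c] lgroup_add_left_mono[of "c + a" "c + b" "- c"] by auto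

lemma lg_add_le_cancel_right: "a + c \<le> b + c \<longleftrightarrow> a \<le> b" for a b c :: "'a::lgroup_add"
  using lgroup_add_right_mono[of a b c] lgroup_add_right_mono[of "a + c" "b + c" "- c"]
  by (auto simp: add.assoc)

lemma lg_add_mono: "a \<le> b \<Longrightarrow> c \<le> d \<Longrightarrow> a + c \<le> b + d" for a b c d :: "'a::lgroup_add"
  by (meson lgroup_add_left_mono lgroup_add_right_mono order_trans)

lemma lg_add_nonneg: "0 \<le> a \<Longrightarrow> 0 \<le> b \<Longrightarrow> 0 \<le> a + b" for a b :: "'a::lgroup_add"
  using lg_add_mono[of 0 a 0 b] by simp

lemma lg_le_add_right: "0 \<le> b \<Longrightarrow> a \<le> a + b" for a b :: "'a::lgroup_add"
  using lgroup_add_left_mono[of 0 b a] by simp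

lemma lg_le_add_left: "0 \<le> b \<Longrightarrow> a \<le> b + a" for a b :: "'a::lgroup_add"
  using lgroup_add_right_mono[of 0 b a] by simp

text \<open>Adding \<open>a\<close> on the left and then \<open>b\<close> on the right turns one
  inequality into the other; the sides matter because addition need not commute.\<close>

lemma lg_minus_le_iff: "- a \<le> - b \<longleftrightarrow> b \<le> a" for a b :: "'a::lgroup_add"
proof -
  have "- a \<le> - b \<longleftrightarrow> a + - a \<le> a + - b" by (simp only: lg_add_le_cancel_left)
  also have "\<dots> \<longleftrightarrow> 0 + b \<le> (a + - b) + b" by (simp only: lg_add_le_cancel_right right_minus)
  finally show ?thesis by (simp add: add.assoc)
qed

text \<open>Translation by \<open>c\<close> is an order automorphism with inverse translation by
  \<open>- c\<close>, so it preserves meets.\<close>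

lemma lg_add_inf_left: "c + inf a b = inf (c + a) (c + b)" for a b c :: "'a::lgroup_add"
proof (rule order.antisym)
  have "- c + inf (c + a) (c + b) \<le> inf a b"
    using lgroup_add_left_mono[of "inf (c + a) (c + b)" "c + a" "- c"]
      lgroup_add_left_mono[of "inf (c + a) (c + b)" "c + b" "- c"] by simp
  then show "inf (c + a) (c + b) \<le> c + inf a b"
    using lg_add_le_cancel_left[of c] by (metis add_minus_cancel)
qed (simp add: lg_add_le_cancel_left)

lemma lg_add_inf_right: "inf a b + c = inf (a + c) (b + c)" for a b c :: "'a::lgroup_add"
proof (rule order.antisym)
  have "inf (a + c) (b + c) + - c \<le> inf a b"
    using lgroup_add_right_mono[of "inf (a + c) (b + c)" "a + c" "- c"]
      lgroup_add_right_mono[of "inf (a + c) (b + c)" "b + c" "- c"] by (simp add: add.assoc)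
  then show "inf (a + c) (b + c) \<le> inf a b + c"
    using lg_add_le_cancel_right[of _ c] by (metis add.assoc add.right_neutral left_minus)
qed (simp add: lg_add_le_cancel_right)

text \<open>The right-hand side expands to the meet of \<open>x + x\<close>, \<open>y + x\<close>,
  \<open>x + z\<close> and \<open>y + z\<close>, of which the first three lie above
  \<open>x\<close>. This inequality makes residuals and polars closed under addition.\<close>

lemma lg_inf_add_le:
  fixes x y z :: "'a::lgroup_add"
  assumes "0 \<le> x" "0 \<le> y" "0 \<le> z"
  shows "inf x (y + z) \<le> inf x y + inf x z"
proof -
  have "inf x y + inf x z = inf (inf (x + x) (y + x)) (inf (x + z) (y + z))"
    by (simp add: lg_add_inf_left lg_add_inf_right)
  moreover have "x \<le> x + x" "x \<le> y + x" "x \<le> x + z"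
    using assms by (auto intro: lg_le_add_left lg_le_add_right)
  ultimately show ?thesis by (simp add: le_infI1)
qed

text \<open>Since \<bar>a\<bar> + \<bar>a\<bar> \<ge> a + (- a) = 0, the element \<open>m\<close> =
  \<bar>a\<bar> \<and> 0 satisfies \<open>m + m = m\<close>, and cancellation gives
  \<open>m = 0\<close>.\<close>

lemma lg_abs_nonneg: "0 \<le> lg_abs a"
proof -
  have le: "a \<le> lg_abs a" "- a \<le> lg_abs a" by (simp_all add: lg_abs_def)
  have nn: "0 \<le> lg_abs a + lg_abs a" using lg_add_mono[OF le] by simp
  define m where "m = inf (lg_abs a) 0"
  have "m + m = inf (inf (lg_abs a + lg_abs a) (lg_abs a)) (inf (lg_abs a) 0)"
    by (simp add: m_def lg_add_inf_left lg_add_inf_right)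
  also have "\<dots> = m"
    unfolding m_def using nn by (intro order.antisym) (auto intro: le_infI1 le_infI2)
  finally have "m + m = m + 0" by simp
  then have "m = 0" by (simp only: add_left_cancel)
  then show ?thesis by (metis inf_le1 m_def)
qed

lemma lg_abs_ge: "a \<le> lg_abs a" "- a \<le> lg_abs a"
  by (simp_all add: lg_abs_def)

lemma lg_abs_le_iff: "lg_abs a \<le> b \<longleftrightarrow> a \<le> b \<and> - a \<le> b"
  by (simp add: lg_abs_def)

lemma lg_abs_minus [simp]: "lg_abs (- a) = lg_abs a"
  by (simp add: lg_abs_def sup_commute)

lemma lg_abs_of_nonneg: "0 \<le> a \<Longrightarrow> lg_abs a = a"
  using lg_minus_le_iff[of a 0] by (simp add: lg_abs_def sup_absorb1)

lemma lg_abs_zero [simp]: "lg_abs 0 = 0"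
  by (simp add: lg_abs_of_nonneg)

lemma lg_abs_abs [simp]: "lg_abs (lg_abs a) = lg_abs a"
  by (simp add: lg_abs_of_nonneg lg_abs_nonneg)

lemma lg_abs_eq_zero [simp]: "lg_abs a = 0 \<longleftrightarrow> a = 0"
proof
  assume "lg_abs a = 0"
  then have "a \<le> 0" "- a \<le> - 0" using lg_abs_ge[of a] by auto
  then show "a = 0" by (simp only: lg_minus_le_iff order.antisym)
qed simp

lemma lg_abs_inf_abs [simp]: "lg_abs (inf (lg_abs a) (lg_abs b)) = inf (lg_abs a) (lg_abs b)"
  by (simp add: lg_abs_of_nonneg lg_abs_nonneg)

lemma lg_abs_sup_abs [simp]: "lg_abs (sup (lg_abs a) (lg_abs b)) = sup (lg_abs a) (lg_abs b)"
  by (simp add: lg_abs_of_nonneg lg_abs_nonneg le_supI1)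

lemma lg_abs_between: "x \<le> z \<Longrightarrow> z \<le> y \<Longrightarrow> lg_abs z \<le> sup (lg_abs x) (lg_abs y)"
  using lg_minus_le_iff[of z x] lg_abs_ge[of x] lg_abs_ge[of y]
  by (meson le_supI1 le_supI2 lg_abs_le_iff order_trans)

lemma lg_sup_le_add: "0 \<le> a \<Longrightarrow> 0 \<le> b \<Longrightarrow> sup a b \<le> a + b" for a b :: "'a::lgroup_add"
  by (simp add: lg_le_add_left lg_le_add_right)

text \<open>The third summand is needed because \<open>- (x + y) = - y - x\<close> reverses the order of summation.\<close>

lemma lg_abs_add_le: "lg_abs (x + y) \<le> lg_abs x + lg_abs y + lg_abs x"
proof -
  have "x + y \<le> lg_abs x + lg_abs y" "- y + - x \<le> lg_abs y + lg_abs x"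
    by (intro lg_add_mono lg_abs_ge)+
  moreover have "lg_abs x + lg_abs y \<le> lg_abs x + lg_abs y + lg_abs x"
      "lg_abs y + lg_abs x \<le> lg_abs x + lg_abs y + lg_abs x"
    by (simp add: lg_le_add_right lg_abs_nonneg)
      (simp only: add.assoc lg_le_add_left lg_abs_nonneg)
  ultimately show ?thesis
    unfolding lg_abs_le_iff minus_add by (meson order_trans)
qed

section \<open>Convex subgroups and polars\<close>

lemma convex_lsubgroups_memI:
  assumes "H \<subseteq> G" "0 \<in> H" "\<And>x. x \<in> H \<Longrightarrow> - x \<in> H"
    and "\<And>x y. x \<in> H \<Longrightarrow> y \<in> H \<Longrightarrow> x + y \<in> H"
    and "\<And>x y. x \<in> H \<Longrightarrow> y \<in> H \<Longrightarrow> inf x y \<in> H"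
    and "\<And>x y. x \<in> H \<Longrightarrow> y \<in> H \<Longrightarrow> sup x y \<in> H"
    and "\<And>x y z. x \<le> z \<Longrightarrow> z \<le> y \<Longrightarrow> x \<in> H \<Longrightarrow> y \<in> H \<Longrightarrow> z \<in> G \<Longrightarrow> z \<in> H"
  shows "H \<in> convex_lsubgroups G"
  unfolding convex_lsubgroups_def
  by (intro CollectI conjI ballI impI assms(1-6); (assumption | (elim conjE, rule assms(7); assumption)))

text \<open>Negatives, sums, meets, joins and elements in between are all dominated in absolute
  value by a sum of absolute values of members, so solidity and addition of nonnegative elements
  suffice.\<close>

lemma convex_lsubgroupI:
  assumes "0 \<in> H"
    and solid: "\<And>x z. x \<in> H \<Longrightarrow> lg_abs z \<le> lg_abs x \<Longrightarrow> z \<in> H"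
    and add: "\<And>x y. x \<in> H \<Longrightarrow> y \<in> H \<Longrightarrow> 0 \<le> x \<Longrightarrow> 0 \<le> y \<Longrightarrow> x + y \<in> H"
  shows "H \<in> convex_lsubgroups UNIV"
proof -
  have abs: "lg_abs x \<in> H" if "x \<in> H" for x
    using solid[OF that, of "lg_abs x"] by simp
  \<comment> \<open>The join \<bar>x\<bar> \<or> \<bar>y\<bar> is not yet known to lie in
    \<open>H\<close>; the sum \<bar>x\<bar> + \<bar>y\<bar>, which does, bounds it.\<close>
  have sup: "z \<in> H" if "x \<in> H" "y \<in> H" "lg_abs z \<le> sup (lg_abs x) (lg_abs y)" for x y z
  proof (rule solid[of "lg_abs x + lg_abs y"])
    show "lg_abs x + lg_abs y \<in> H" using that abs add lg_abs_nonneg by blast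
    have "lg_abs z \<le> lg_abs x + lg_abs y"
      using that(3) lg_sup_le_add[OF lg_abs_nonneg lg_abs_nonneg] by (rule order_trans)
    then show "lg_abs z \<le> lg_abs (lg_abs x + lg_abs y)"
      by (simp add: lg_abs_of_nonneg lg_add_nonneg lg_abs_nonneg)
  qed
  have "x + y \<in> H" if "x \<in> H" "y \<in> H" for x y
  proof (rule solid)
    show "lg_abs x + lg_abs y + lg_abs x \<in> H"
      using that by (intro add abs lg_add_nonneg lg_abs_nonneg)
    show "lg_abs (x + y) \<le> lg_abs (lg_abs x + lg_abs y + lg_abs x)"
      by (simp add: lg_abs_of_nonneg lg_add_nonneg lg_abs_nonneg lg_abs_add_le)
  qed
  moreover have "inf x y \<in> H" "sup x y \<in> H" if "x \<in> H" "y \<in> H" for x y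
  proof -
    have "lg_abs (inf x y) \<le> sup (lg_abs x) (lg_abs y)"
    proof -
      have "- x \<le> sup (lg_abs x) (lg_abs y)" "- y \<le> sup (lg_abs x) (lg_abs y)"
        by (simp_all add: lg_abs_ge le_supI1 le_supI2)
      then have "- sup (lg_abs x) (lg_abs y) \<le> inf x y"
        using lg_minus_le_iff[of _ "- sup (lg_abs x) (lg_abs y)"] by simp
      then have "- inf x y \<le> sup (lg_abs x) (lg_abs y)"
        using lg_minus_le_iff[of "inf x y" "- sup (lg_abs x) (lg_abs y)"] by simp
      then show ?thesis
        by (simp add: lg_abs_le_iff le_infI1 le_supI1 lg_abs_ge)
    qed
    then show "inf x y \<in> H" using sup that by blast
    have "- sup x y \<le> - x" by (simp add: lg_minus_le_iff)
    then have "lg_abs (sup x y) \<le> sup (lg_abs x) (lg_abs y)"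
      using lg_abs_ge(1)[of x] lg_abs_ge(1)[of y] lg_abs_ge(2)[of x] le_supI1 order_trans sup_mono
      by (metis lg_abs_le_iff)
    then show "sup x y \<in> H" using sup that by blast
  qed
  moreover have "z \<in> H" if "x \<le> z" "z \<le> y" "x \<in> H" "y \<in> H" for x y z
    using that(3,4) lg_abs_between[OF that(1,2)] by (rule sup)
  moreover have "- x \<in> H" if "x \<in> H" for x
    using solid[OF that] by simp
  ultimately show ?thesis
    using \<open>0 \<in> H\<close> by - (rule convex_lsubgroups_memI; (rule subset_UNIV | assumption))
qed

lemma convex_lsubgroupD:
  assumes "H \<in> convex_lsubgroups G"
  shows "H \<subseteq> G" "0 \<in> H" "x \<in> H \<Longrightarrow> - x \<in> H"
    and "x \<in> H \<Longrightarrow> y \<in> H \<Longrightarrow> x + y \<in> H"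
    and "x \<in> H \<Longrightarrow> y \<in> H \<Longrightarrow> inf x y \<in> H"
    and "x \<in> H \<Longrightarrow> y \<in> H \<Longrightarrow> sup x y \<in> H"
    and "x \<in> H \<Longrightarrow> y \<in> H \<Longrightarrow> z \<in> G \<Longrightarrow> x \<le> z \<Longrightarrow> z \<le> y \<Longrightarrow> z \<in> H"
proof -
  note * = assms[unfolded convex_lsubgroups_def mem_Collect_eq]
  show "H \<subseteq> G" using * by (rule conjunct1)
  show "0 \<in> H" using *[THEN conjunct2] by (rule conjunct1)
  show "- x \<in> H" if "x \<in> H" using * that by (elim conjE) (rule bspec)
  show "x + y \<in> H" "inf x y \<in> H" "sup x y \<in> H" if "x \<in> H" "y \<in> H"
    using *[THEN conjunct2, THEN conjunct2, THEN conjunct2, THEN conjunct1, rule_format, OF that]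
    by (safe; assumption)+
  show "z \<in> H" if "x \<in> H" "y \<in> H" "z \<in> G" "x \<le> z" "z \<le> y"
    using *[THEN conjunct2, THEN conjunct2, THEN conjunct2, THEN conjunct2, rule_format,
        OF that(1-3) conjI[OF that(4,5)]] .
qed

context
  fixes H :: "'a::lgroup_add set"
  assumes H: "H \<in> convex_lsubgroups UNIV"
begin

lemma convex_lsubgroup_zero: "0 \<in> H"
  using H by (rule convex_lsubgroupD)

lemma convex_lsubgroup_add: "x \<in> H \<Longrightarrow> y \<in> H \<Longrightarrow> x + y \<in> H"
  using H by (rule convex_lsubgroupD)

lemma convex_lsubgroup_abs_iff: "lg_abs x \<in> H \<longleftrightarrow> x \<in> H"
proof
  assume "lg_abs x \<in> H"
  moreover from this have "- lg_abs x \<in> H" by (rule convex_lsubgroupD(3)[OF H])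
  moreover have "- lg_abs x \<le> x" "x \<le> lg_abs x"
    using lg_abs_ge[of x] lg_minus_le_iff[of "lg_abs x" "- x"] by simp_all
  ultimately show "x \<in> H" by - (rule convex_lsubgroupD(7)[OF H _ _ UNIV_I])
qed (simp add: convex_lsubgroupD(3,6)[OF H] lg_abs_def)

lemma convex_lsubgroup_le: "x \<in> H \<Longrightarrow> 0 \<le> z \<Longrightarrow> z \<le> x \<Longrightarrow> z \<in> H"
  by (rule convex_lsubgroupD(7)[OF H convex_lsubgroup_zero _ UNIV_I])

lemma convex_lsubgroup_solid: "x \<in> H \<Longrightarrow> lg_abs z \<le> lg_abs x \<Longrightarrow> z \<in> H"
  using convex_lsubgroup_le[of "lg_abs x" "lg_abs z"] convex_lsubgroup_abs_iff lg_abs_nonneg by blast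

text \<open>Closure under addition comes from y \<and> (x + z) \<le> (y \<and> x) + (y \<and> z) for
  nonnegative elements, followed by convexity of \<open>H\<close>. Polars of single elements are the
  case \<open>H = {0}\<close>.\<close>

lemma convex_lsubgroup_residual:
  assumes "0 \<le> y"
  shows "{x. inf (lg_abs x) y \<in> H} \<in> convex_lsubgroups UNIV"
proof (rule convex_lsubgroupI)
  show "0 \<in> {x. inf (lg_abs x) y \<in> H}"
    using assms convex_lsubgroup_zero by (simp add: inf_absorb1)
next
  fix x z assume "x \<in> {x. inf (lg_abs x) y \<in> H}" "lg_abs z \<le> lg_abs x"
  then have "inf (lg_abs x) y \<in> H" "inf (lg_abs z) y \<le> inf (lg_abs x) y"
    by (auto intro: le_infI1)
  then show "z \<in> {x. inf (lg_abs x) y \<in> H}"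
    using convex_lsubgroup_le le_infI[OF lg_abs_nonneg[of z] assms] by blast
next
  fix x z assume *: "x \<in> {x. inf (lg_abs x) y \<in> H}" "z \<in> {x. inf (lg_abs x) y \<in> H}" "0 \<le> x" "0 \<le> z"
  then have "inf y x + inf y z \<in> H"
    by (simp add: convex_lsubgroup_add lg_abs_of_nonneg inf_commute)
  moreover have "inf y (x + z) \<le> inf y x + inf y z" "0 \<le> inf y (x + z)"
    using * assms by (simp_all add: lg_inf_add_le lg_add_nonneg)
  ultimately have "inf y (x + z) \<in> H" using convex_lsubgroup_le by blast
  then show "x + z \<in> {x. inf (lg_abs x) y \<in> H}"
    using * by (simp add: lg_abs_of_nonneg lg_add_nonneg inf_commute)
qed

end

lemma convex_lsubgroup_singleton_zero: "{0} \<in> convex_lsubgroups (UNIV :: 'a::lgroup_add set)"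
proof (rule convex_lsubgroupI)
  fix x z :: 'a assume "x \<in> {0}" "lg_abs z \<le> lg_abs x"
  then have "lg_abs z = 0" using lg_abs_nonneg[of z] by (simp add: order.antisym)
  then show "z \<in> {0}" by simp
qed auto

lemma convex_lsubgroup_Inter:
  assumes "\<And>H. H \<in> \<H> \<Longrightarrow> H \<in> convex_lsubgroups (UNIV :: 'a::lgroup_add set)"
  shows "\<Inter>\<H> \<in> convex_lsubgroups UNIV"
  by (rule convex_lsubgroupI)
    (auto dest: assms intro: convex_lsubgroup_zero convex_lsubgroup_solid convex_lsubgroup_add)

lemma convex_lsubgroup_Union_chain:
  assumes "\<C> \<noteq> {}" "subset.chain (convex_lsubgroups (UNIV :: 'a::lgroup_add set)) \<C>"
  shows "\<Union>\<C> \<in> convex_lsubgroups UNIV"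
proof (rule convex_lsubgroupI)
  have C: "X \<in> convex_lsubgroups UNIV" if "X \<in> \<C>" for X
    using assms that by (auto simp: subset.chain_def)
  then show "0 \<in> \<Union>\<C>" using assms(1) convex_lsubgroup_zero by blast
  show "z \<in> \<Union>\<C>" if "x \<in> \<Union>\<C>" "lg_abs z \<le> lg_abs x" for x z
    using that C convex_lsubgroup_solid by blast
  fix x y assume "x \<in> \<Union>\<C>" "y \<in> \<Union>\<C>"
  then obtain X Y where XY: "X \<in> \<C>" "Y \<in> \<C>" "x \<in> X" "y \<in> Y" by blast
  then have "X \<subseteq> Y \<or> Y \<subseteq> X" using assms(2) by (auto simp: subset_chain_def)
  then obtain Z where "Z \<in> \<C>" "x \<in> Z" "y \<in> Z" using XY by blast
  then show "x + y \<in> \<Union>\<C>" using C convex_lsubgroup_add by blast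
qed

section \<open>Polars\<close>

lemma mem_perp: "h \<in> perp UNIV S \<longleftrightarrow> (\<forall>s\<in>S. inf (lg_abs h) (lg_abs s) = 0)"
  by (simp add: perp_def)

lemma mem_perp_singleton: "h \<in> perp UNIV {a} \<longleftrightarrow> inf (lg_abs h) (lg_abs a) = 0"
  by (simp add: perp_def)

lemma perp_antimono: "S \<subseteq> T \<Longrightarrow> perp G T \<subseteq> perp G S"
  by (auto simp: perp_def)

lemma subset_perp_perp: "S \<subseteq> perp UNIV (perp UNIV S)"
  by (auto simp: perp_def inf_commute)

lemma perp_perp_perp: "perp UNIV (perp UNIV (perp UNIV S)) = perp UNIV S"
  by (meson order.antisym perp_antimono subset_perp_perp)

text \<open>Polar and double polar determine each other, because applying \<open>perp\<close> a
  third time returns the polar.\<close>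

lemma perp_singleton_eq_iff:
  "perp UNIV {a} = perp UNIV {b} \<longleftrightarrow>
     perp UNIV (perp UNIV {a}) = perp UNIV (perp UNIV {b})"
  by (metis perp_perp_perp)

text \<open>A polar is the intersection of residuals of \<open>{0}\<close>, one for each element of
  \<open>S\<close>.\<close>

lemma perp_convex_lsubgroup: "perp UNIV S \<in> convex_lsubgroups UNIV"
proof -
  have "perp UNIV S = \<Inter> ((\<lambda>s. {h. inf (lg_abs h) (lg_abs s) \<in> {0}}) ` S)"
    by (auto simp: perp_def)
  also have "\<dots> \<in> convex_lsubgroups UNIV"
    by (rule convex_lsubgroup_Inter)
      (auto intro!: convex_lsubgroup_residual[OF convex_lsubgroup_singleton_zero, simplified] lg_abs_nonneg)
  finally show ?thesis .
qed

section \<open>Principal convex subgroups\<close>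

lemma funpow_add_eq: "((+) a ^^ (m + n)) 0 = ((+) a ^^ m) 0 + ((+) a ^^ n) 0"
  for a :: "'a::group_add"
  by (induction m) (simp_all add: add.assoc)

lemma principal_lsubgroup_convex: "principal_lsubgroup UNIV a \<in> convex_lsubgroups UNIV"
proof (rule convex_lsubgroupI)
  show "0 \<in> principal_lsubgroup UNIV a"
    by (auto simp: principal_lsubgroup_def intro!: exI[of _ 0])
  show "z \<in> principal_lsubgroup UNIV a"
    if "x \<in> principal_lsubgroup UNIV a" "lg_abs z \<le> lg_abs x" for x z
    using that by (auto simp: principal_lsubgroup_def intro: order_trans)
  fix x y assume *: "x \<in> principal_lsubgroup UNIV a" "y \<in> principal_lsubgroup UNIV a" "0 \<le> x" "0 \<le> y"
  then obtain m n where "x \<le> ((+) (lg_abs a) ^^ m) 0" "y \<le> ((+) (lg_abs a) ^^ n) 0"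
    by (auto simp: principal_lsubgroup_def lg_abs_of_nonneg)
  then have "lg_abs (x + y) \<le> ((+) (lg_abs a) ^^ (m + n)) 0"
    unfolding funpow_add_eq using * by (simp add: lg_abs_of_nonneg lg_add_nonneg lg_add_mono)
  then show "x + y \<in> principal_lsubgroup UNIV a"
    unfolding principal_lsubgroup_def by blast
qed

lemma principal_lsubgroup_self: "a \<in> principal_lsubgroup UNIV a"
  by (auto simp: principal_lsubgroup_def intro!: exI[of _ 1])

text \<open>\<open>H\<close> contains every multiple of \<bar>a\<bar> by induction, hence by
  convexity everything they dominate. Inclusions of principal subgroups thereby become membership
  statements.\<close>

lemma principal_lsubgroup_subset_iff:
  assumes "H \<in> convex_lsubgroups UNIV"
  shows "principal_lsubgroup UNIV a \<subseteq> H \<longleftrightarrow> a \<in> H"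
proof
  assume "a \<in> H"
  have "((+) (lg_abs a) ^^ n) 0 \<in> H" for n
    using \<open>a \<in> H\<close> assms
    by (induction n) (simp_all add: convex_lsubgroup_zero convex_lsubgroup_add convex_lsubgroup_abs_iff)
  then show "principal_lsubgroup UNIV a \<subseteq> H"
    unfolding principal_lsubgroup_def
    using assms convex_lsubgroup_abs_iff convex_lsubgroup_le lg_abs_nonneg by blast
qed (use principal_lsubgroup_self in blast)

text \<open>The double polar is convex and contains \<open>a\<close>. Only the reverse inclusion
  remains to be discussed later.\<close>

lemma principal_lsubgroup_subset_perp_perp:
  "principal_lsubgroup UNIV a \<subseteq> perp UNIV (perp UNIV {a})"
  using principal_lsubgroup_subset_iff[OF perp_convex_lsubgroup] subset_perp_perp[of "{a}"] by blast

text \<open>The meet \<bar>a\<bar> \<and> \<bar>b\<bar> lies in both subgroups. If it vanishes, a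
  common element lies in the polar of \<open>a\<close> and in its double polar, so it is disjoint
  from itself and is 0.\<close>

lemma principal_lsubgroup_Int_eq_zero_iff:
  "principal_lsubgroup UNIV a \<inter> principal_lsubgroup UNIV b = {0} \<longleftrightarrow> inf (lg_abs a) (lg_abs b) = 0"
proof
  have "inf (lg_abs a) (lg_abs b) \<in> principal_lsubgroup UNIV a \<inter> principal_lsubgroup UNIV b"
    by (intro IntI; rule convex_lsubgroup_solid[OF principal_lsubgroup_convex principal_lsubgroup_self])
      simp_all
  then show "inf (lg_abs a) (lg_abs b) = 0"
    if "principal_lsubgroup UNIV a \<inter> principal_lsubgroup UNIV b = {0}" using that by blast
next
  assume "inf (lg_abs a) (lg_abs b) = 0"
  then have "principal_lsubgroup UNIV b \<subseteq> perp UNIV {a}"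
    by (simp add: principal_lsubgroup_subset_iff perp_convex_lsubgroup mem_perp_singleton inf_commute)
  then have "x = 0" if "x \<in> principal_lsubgroup UNIV a" "x \<in> principal_lsubgroup UNIV b" for x
    using that principal_lsubgroup_subset_perp_perp[of a] mem_perp[of x "perp UNIV {a}"] by force
  then show "principal_lsubgroup UNIV a \<inter> principal_lsubgroup UNIV b = {0}"
    using convex_lsubgroup_zero[OF principal_lsubgroup_convex] by blast
qed

text \<open>Passing from \<open>a\<close> to \<bar>a\<bar> \<or> \<bar>h\<bar> brings
  \<open>h\<close> into the principal subgroup without changing the polar: if \<open>x\<close> is
  disjoint from \<open>a\<close>, then the polar of \<open>x\<close> contains both \<open>a\<close>
  and \<open>h\<close>, hence also the join.\<close>

lemma perp_singleton_sup:
  assumes "h \<in> perp UNIV (perp UNIV {a})"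
  shows "perp UNIV {sup (lg_abs a) (lg_abs h)} = perp UNIV {a}"
proof
  have "inf (lg_abs x) (lg_abs a) = 0" if "inf (lg_abs x) (sup (lg_abs a) (lg_abs h)) = 0" for x
  proof -
    have "inf (lg_abs x) (lg_abs a) \<le> inf (lg_abs x) (sup (lg_abs a) (lg_abs h))"
      by (rule inf_mono) auto
    then show ?thesis using that by (simp add: order.antisym lg_abs_nonneg)
  qed
  then show "perp UNIV {sup (lg_abs a) (lg_abs h)} \<subseteq> perp UNIV {a}"
    by (auto simp: mem_perp_singleton)
  show "perp UNIV {a} \<subseteq> perp UNIV {sup (lg_abs a) (lg_abs h)}"
  proof
    fix x assume "x \<in> perp UNIV {a}"
    then have "a \<in> perp UNIV {x}" "h \<in> perp UNIV {x}"
      using assms by (auto simp: mem_perp inf_commute)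
    then have "sup (lg_abs a) (lg_abs h) \<in> perp UNIV {x}"
      by (simp add: convex_lsubgroupD(6)[OF perp_convex_lsubgroup]
          convex_lsubgroup_abs_iff[OF perp_convex_lsubgroup])
    then show "x \<in> perp UNIV {sup (lg_abs a) (lg_abs h)}"
      by (simp add: mem_perp_singleton inf_commute)
  qed
qed

section \<open>Prime subgroups\<close>

lemma Spec_convex: "p \<in> Spec UNIV \<Longrightarrow> p \<in> convex_lsubgroups UNIV"
  by (simp add: Spec_def)

lemma Spec_disjoint:
  assumes "p \<in> Spec UNIV" "inf (lg_abs a) (lg_abs b) = 0"
  shows "a \<in> p \<or> b \<in> p"
  using assms convex_lsubgroup_abs_iff[OF Spec_convex] unfolding Spec_def by blast

text \<open>Primality is assumed only for pairs with meet 0. Subtracting the meet \<open>m\<close>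
  from \<bar>a\<bar> and \<bar>b\<bar> produces such a pair, and adding \<open>m \<in> p\<close>
  back recovers \<bar>a\<bar> or \<bar>b\<bar>.\<close>

lemma Spec_inf_iff:
  assumes "p \<in> Spec UNIV"
  shows "inf (lg_abs a) (lg_abs b) \<in> p \<longleftrightarrow> a \<in> p \<or> b \<in> p"
proof
  note C = Spec_convex[OF assms]
  define m where "m = inf (lg_abs a) (lg_abs b)"
  assume m: "inf (lg_abs a) (lg_abs b) \<in> p"
  have "inf (lg_abs a + - m) (lg_abs b + - m) = 0"
    unfolding lg_add_inf_right[symmetric] by (simp add: m_def)
  then have "lg_abs a + - m \<in> p \<or> lg_abs b + - m \<in> p"
    using assms by (simp add: Spec_def)
  then have "(lg_abs a + - m) + m \<in> p \<or> (lg_abs b + - m) + m \<in> p"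
    using convex_lsubgroup_add[OF C _ m[folded m_def]] by blast
  then show "a \<in> p \<or> b \<in> p"
    using convex_lsubgroup_abs_iff[OF C] by (simp add: add.assoc)
next
  assume "a \<in> p \<or> b \<in> p"
  then show "inf (lg_abs a) (lg_abs b) \<in> p"
    using convex_lsubgroup_solid[OF Spec_convex[OF assms]] lg_abs_inf_abs[of a b]
    by (metis inf_le1 inf_le2)
qed

lemma Spec_sup_iff:
  assumes "p \<in> Spec UNIV"
  shows "sup (lg_abs a) (lg_abs b) \<in> p \<longleftrightarrow> a \<in> p \<and> b \<in> p"
proof -
  note C = Spec_convex[OF assms]
  have "a \<in> p \<and> b \<in> p" if "sup (lg_abs a) (lg_abs b) \<in> p"
    using convex_lsubgroup_solid[OF C that] by simp
  moreover have "sup (lg_abs a) (lg_abs b) \<in> p" if "a \<in> p" "b \<in> p"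
    using that by (simp add: convex_lsubgroupD(6)[OF C] convex_lsubgroup_abs_iff[OF C])
  ultimately show ?thesis by blast
qed

text \<open>
  Primality of a maximal convex \<open>\<ell>\<close>-subgroup avoiding \<open>S\<close> is obtained from its residuals
  \<open>{x. \<bar>x\<bar> \<and> y \<in> M}\<close>, which avoids describing generated subgroups.
\<close>

lemma prime_separation:
  assumes "H \<in> convex_lsubgroups UNIV" "S \<noteq> {}" "\<And>s. s \<in> S \<Longrightarrow> 0 \<le> s"
    and S: "\<And>s t. s \<in> S \<Longrightarrow> t \<in> S \<Longrightarrow> inf s t \<in> S" and "H \<inter> S = {}"
  obtains p where "p \<in> Spec UNIV" "H \<subseteq> p" "p \<inter> S = {}"
proof -
  define \<A> where "\<A> = {K \<in> convex_lsubgroups UNIV. H \<subseteq> K \<and> K \<inter> S = {}}"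
  have "\<exists>M\<in>\<A>. \<forall>X\<in>\<A>. M \<subseteq> X \<longrightarrow> X = M"
  proof (rule subset_Zorn_nonempty)
    show "\<A> \<noteq> {}" using assms by (auto simp: \<A>_def)
    fix \<C> assume C: "\<C> \<noteq> {}" "subset.chain \<A> \<C>"
    then have "subset.chain (convex_lsubgroups UNIV) \<C>"
      by (auto simp: subset_chain_def \<A>_def)
    moreover have "H \<subseteq> \<Union>\<C>" "\<Union>\<C> \<inter> S = {}"
      using C unfolding subset_chain_def \<A>_def by blast+
    ultimately show "\<Union>\<C> \<in> \<A>"
      using C convex_lsubgroup_Union_chain by (simp add: \<A>_def)
  qed
  then obtain M where M: "M \<in> convex_lsubgroups UNIV" "H \<subseteq> M" "M \<inter> S = {}"
    and max: "\<And>X. X \<in> \<A> \<Longrightarrow> M \<subseteq> X \<Longrightarrow> X = M"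
    by (auto simp: \<A>_def)
  \<comment> \<open>The residual of \<open>M\<close> by \<open>y\<close> contains \<open>M\<close>
    and the further element \<open>x\<close>, so by maximality of \<open>M\<close> it must meet
    \<open>S\<close>.\<close>
  have meets: "\<exists>s\<in>S. inf s y \<in> M" if "0 \<le> y" "x \<notin> M" "inf (lg_abs x) y \<in> M" for x y
  proof (rule ccontr)
    let ?Q = "{x. inf (lg_abs x) y \<in> M}"
    assume no: "\<not> ?thesis"
    have "M \<subseteq> ?Q"
    proof
      fix z assume "z \<in> M"
      then have "lg_abs z \<in> M" by (simp add: convex_lsubgroup_abs_iff[OF M(1)])
      then show "z \<in> ?Q"
        using convex_lsubgroup_le[OF M(1), of "lg_abs z"] \<open>0 \<le> y\<close> lg_abs_nonneg[of z] by simp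
    qed
    moreover have "?Q \<inter> S = {}" using no assms(3) lg_abs_of_nonneg by fastforce
    ultimately have "?Q \<in> \<A>"
      using M(2) convex_lsubgroup_residual[OF M(1) \<open>0 \<le> y\<close>] by (auto simp: \<A>_def)
    then show False using max \<open>M \<subseteq> ?Q\<close> that by blast
  qed
  have "a \<in> M \<or> b \<in> M" if zero: "inf a b = 0" for a b
  proof (rule ccontr)
    assume "\<not> (a \<in> M \<or> b \<in> M)"
    then have notin: "a \<notin> M" "b \<notin> M" by blast+
    have ab: "0 \<le> a" "0 \<le> b" using zero by (metis inf_le1 inf_le2)+
    \<comment> \<open>The residual of \<open>M\<close> by \<open>b\<close> contains \<open>a\<close>
      and yields \<open>s\<close>. Then s \<and> b \<in> M puts \<open>b\<close> into the residual
      by \<open>s\<close>, which yields \<open>t\<close> with t \<and> s \<in> M, although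
      \<open>S\<close> is closed under meets.\<close>
    obtain s where s: "s \<in> S" "inf s b \<in> M"
      using meets[of b a] notin ab zero convex_lsubgroup_zero[OF M(1)]
      by (auto simp: lg_abs_of_nonneg)
    then obtain t where t: "t \<in> S" "inf t s \<in> M"
      using meets[of s b] notin ab assms(3) by (auto simp: lg_abs_of_nonneg inf_commute)
    then show False using S[OF t(1) s(1)] M(3) by blast
  qed
  then have "M \<in> Spec UNIV" using M assms(2) by (auto simp: Spec_def)
  then show ?thesis using that M by blast
qed

text \<open>Separation from the one-element set of \<bar>h\<bar>. It follows that a convex subgroup
  is the intersection of the primes above it.\<close>

lemma prime_not_containing:
  assumes "H \<in> convex_lsubgroups UNIV" "h \<notin> H"
  obtains p where "p \<in> Spec UNIV" "H \<subseteq> p" "h \<notin> p"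
proof -
  obtain p where "p \<in> Spec UNIV" "H \<subseteq> p" "p \<inter> {lg_abs h} = {}"
    by (rule prime_separation[of H "{lg_abs h}"])
      (use assms convex_lsubgroup_abs_iff in \<open>auto simp: lg_abs_nonneg\<close>)
  then show ?thesis using that convex_lsubgroup_abs_iff[OF Spec_convex] by blast
qed

text \<open>A maximal filter of positive elements is the positive part of the complement of a minimal prime.\<close>

lemma minimal_prime_not_containing:
  assumes "a \<noteq> 0"
  obtains p where "p \<in> Min_Spec UNIV" "a \<notin> p"
proof -
  define \<A> where "\<A> = {S. lg_abs a \<in> S \<and> (\<forall>s\<in>S. 0 \<le> s) \<and> 0 \<notin> S \<and> (\<forall>s\<in>S. \<forall>t\<in>S. inf s t \<in> S)}"
  have "\<exists>M\<in>\<A>. \<forall>X\<in>\<A>. M \<subseteq> X \<longrightarrow> X = M"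
  proof (rule subset_Zorn_nonempty)
    have "{lg_abs a} \<in> \<A>" using assms by (auto simp: \<A>_def lg_abs_nonneg)
    then show "\<A> \<noteq> {}" by blast
    fix \<C> assume C: "\<C> \<noteq> {}" "subset.chain \<A> \<C>"
    have "inf s t \<in> \<Union>\<C>" if st: "s \<in> \<Union>\<C>" "t \<in> \<Union>\<C>" for s t
    proof -
      obtain X Y where XY: "X \<in> \<C>" "Y \<in> \<C>" "s \<in> X" "t \<in> Y" using st by blast
      then have "X \<subseteq> Y \<or> Y \<subseteq> X" using C(2) by (auto simp: subset_chain_def)
      then obtain Z where "Z \<in> \<C>" "s \<in> Z" "t \<in> Z" using XY by blast
      then show ?thesis using C(2) by (auto simp: subset_chain_def \<A>_def)
    qed
    moreover have "lg_abs a \<in> \<Union>\<C>" "\<forall>s\<in>\<Union>\<C>. 0 \<le> s" "0 \<notin> \<Union>\<C>"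
      using C by (auto simp: subset_chain_def \<A>_def)
    ultimately show "\<Union>\<C> \<in> \<A>" by (simp add: \<A>_def)
  qed
  then obtain S where S: "S \<in> \<A>" and max: "\<And>X. X \<in> \<A> \<Longrightarrow> S \<subseteq> X \<Longrightarrow> X = S" by blast
  have "{0} \<inter> S = {}" using S by (auto simp: \<A>_def)
  then obtain p where p: "p \<in> Spec UNIV" "p \<inter> S = {}"
    using S by (auto simp: \<A>_def intro: prime_separation[OF convex_lsubgroup_singleton_zero, of S])
  have "q = p" if q: "q \<in> Spec UNIV" "q \<subseteq> p" for q
  proof -
    \<comment> \<open>For a prime \<open>q\<close> inside \<open>p\<close>, the nonnegative elements
      outside \<open>q\<close> form a member of \<open>\<A>\<close> that includes \<open>S\<close>,
      so \<open>T = S\<close> by maximality. An \<open>x \<in> p\<close> then has \<bar>x\<bar>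
      outside \<open>T\<close>, that is, in \<open>q\<close>.\<close>
    define T where "T = {x. 0 \<le> x \<and> x \<notin> q}"
    have "inf s t \<in> T" if "s \<in> T" "t \<in> T" for s t
      using that Spec_inf_iff[OF q(1), of s t] by (simp add: T_def lg_abs_of_nonneg)
    moreover have ST: "S \<subseteq> T" using S p(2) q(2) by (auto simp: T_def \<A>_def)
    moreover have "0 \<notin> T" using convex_lsubgroup_zero[OF Spec_convex[OF q(1)]] by (simp add: T_def)
    ultimately have "T \<in> \<A>" using S by (auto simp: \<A>_def T_def)
    then have "T = S" using max ST by blast
    have "x \<in> q" if "x \<in> p" for x
    proof -
      have "lg_abs x \<notin> T"
        using that p(2) \<open>T = S\<close> convex_lsubgroup_abs_iff[OF Spec_convex[OF p(1)]] by blast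
      then show ?thesis
        using convex_lsubgroup_abs_iff[OF Spec_convex[OF q(1)]] by (simp add: T_def lg_abs_nonneg)
    qed
    then show ?thesis using q(2) by blast
  qed
  then have "p \<in> Min_Spec UNIV" using p(1) by (auto simp: Min_Spec_def)
  moreover have "a \<notin> p"
    using S p convex_lsubgroup_abs_iff[OF Spec_convex[OF p(1)]] by (auto simp: \<A>_def)
  ultimately show ?thesis using that by blast
qed

text \<open>Otherwise the elements \<bar>a\<bar> \<and> \<bar>b\<bar> with
  \<open>b \<notin> p\<close> form a meet-closed set without 0. A prime \<open>q\<close> missing
  this set lies inside \<open>p\<close>, so \<open>q = p\<close> by minimality; but then
  \<open>a \<in> q\<close> makes \<open>q\<close> meet the set.\<close>

lemma minimal_prime_witness:
  assumes "p \<in> Min_Spec UNIV" "a \<in> p"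
  shows "\<exists>b. b \<notin> p \<and> inf (lg_abs a) (lg_abs b) = 0"
proof (rule ccontr)
  assume "\<not> ?thesis"
  then have no: "inf (lg_abs a) (lg_abs b) \<noteq> 0" if "b \<notin> p" for b
    using that by blast
  have p: "p \<in> Spec UNIV" using assms by (simp add: Min_Spec_def)
  define S where "S = {inf (lg_abs a) (lg_abs b) | b. b \<notin> p}"
  have "S \<noteq> {}" using p by (auto simp: S_def Spec_def)
  moreover have "inf s t \<in> S" if st: "s \<in> S" "t \<in> S" for s t
  proof -
    obtain b c where bc: "s = inf (lg_abs a) (lg_abs b)" "b \<notin> p" "t = inf (lg_abs a) (lg_abs c)" "c \<notin> p"
      using st by (auto simp: S_def)
    then have "inf s t = inf (lg_abs a) (lg_abs (inf (lg_abs b) (lg_abs c)))"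
      by (simp add: inf_assoc inf_left_commute)
    then show ?thesis using bc Spec_inf_iff[OF p] unfolding S_def by blast
  qed
  moreover have "0 \<le> s" if "s \<in> S" for s using that by (auto simp: S_def lg_abs_nonneg)
  moreover have "{0} \<inter> S = {}" using no by (auto simp: S_def)
  ultimately obtain q where q: "q \<in> Spec UNIV" "q \<inter> S = {}"
    using prime_separation[OF convex_lsubgroup_singleton_zero, of S] by metis
  have "q \<subseteq> p"
  proof
    fix x assume "x \<in> q"
    then have "inf (lg_abs a) (lg_abs x) \<in> q" using Spec_inf_iff[OF q(1)] by blast
    then show "x \<in> p" using q(2) by (auto simp: S_def)
  qed
  then have "q = p" using assms(1) q(1) by (simp add: Min_Spec_def)
  moreover obtain b where "b \<notin> p" using p by (auto simp: Spec_def)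
  ultimately have "inf (lg_abs a) (lg_abs b) \<in> q \<inter> S"
    using assms(2) Spec_inf_iff[OF q(1)] by (auto simp: S_def)
  then show False using q(2) by blast
qed

text \<open>A minimal prime containing \<open>a\<close> misses some \<open>b\<close> disjoint from
  \<open>a\<close>; elements of the double polar are disjoint from \<open>b\<close>, so primality
  puts them into the prime. Conversely, if \<open>k\<close> is disjoint from \<open>a\<close> but
  not from \<open>h\<close>, a minimal prime missing \<bar>h\<bar> \<and> \<bar>k\<bar> contains
  \<open>a\<close> and misses \<open>h\<close>.\<close>

lemma perp_perp_eq_Inter_minimal_primes:
  "perp UNIV (perp UNIV {a}) = \<Inter> {p \<in> Min_Spec UNIV. a \<in> p}"
proof (intro equalityI subsetI)
  fix h assume h: "h \<in> perp UNIV (perp UNIV {a})"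
  have "h \<in> p" if p: "p \<in> Min_Spec UNIV" "a \<in> p" for p
  proof -
    obtain b where b: "b \<notin> p" "inf (lg_abs a) (lg_abs b) = 0"
      using minimal_prime_witness[OF p] by blast
    then have "inf (lg_abs h) (lg_abs b) = 0" using h by (simp add: mem_perp inf_commute)
    then show ?thesis using Spec_disjoint p(1) b(1) by (auto simp: Min_Spec_def)
  qed
  then show "h \<in> \<Inter> {p \<in> Min_Spec UNIV. a \<in> p}" by blast
next
  fix h assume h: "h \<in> \<Inter> {p \<in> Min_Spec UNIV. a \<in> p}"
  show "h \<in> perp UNIV (perp UNIV {a})"
  proof (rule ccontr)
    assume "\<not> ?thesis"
    then obtain k where k: "inf (lg_abs k) (lg_abs a) = 0" "inf (lg_abs h) (lg_abs k) \<noteq> 0"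
      by (auto simp: mem_perp)
    obtain p where p: "p \<in> Min_Spec UNIV" "inf (lg_abs h) (lg_abs k) \<notin> p"
      using k(2) by (rule minimal_prime_not_containing)
    then have "p \<in> Spec UNIV" by (simp add: Min_Spec_def)
    then have "a \<in> p" "h \<notin> p"
      using p(2) k(1) Spec_disjoint Spec_inf_iff by blast+
    then show False using h p(1) by blast
  qed
qed

text \<open>Inclusions are compared first, using that a principal subgroup is the intersection of
  the primes containing its generator; equality follows by antisymmetry.\<close>

lemma principal_lsubgroup_eq_iff_Spec_U:
  "principal_lsubgroup UNIV a = principal_lsubgroup UNIV b \<longleftrightarrow> Spec_U UNIV a = Spec_U UNIV b"
proof -
  have "principal_lsubgroup UNIV a \<subseteq> principal_lsubgroup UNIV b \<longleftrightarrow> Spec_U UNIV a \<subseteq> Spec_U UNIV b" for a b :: 'a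
  proof -
    have "Spec_U UNIV a \<subseteq> Spec_U UNIV b" if "principal_lsubgroup UNIV a \<subseteq> principal_lsubgroup UNIV b"
    proof -
      have "a \<in> p" if "p \<in> Spec UNIV" "b \<in> p" for p
        using principal_lsubgroup_subset_iff[OF Spec_convex[OF that(1)]] that(2)
          \<open>principal_lsubgroup UNIV a \<subseteq> principal_lsubgroup UNIV b\<close> by blast
      then show ?thesis by (auto simp: Spec_U_def)
    qed
    moreover have "a \<in> principal_lsubgroup UNIV b" if "Spec_U UNIV a \<subseteq> Spec_U UNIV b"
    proof (rule ccontr)
      assume "a \<notin> principal_lsubgroup UNIV b"
      then obtain p where "p \<in> Spec UNIV" "principal_lsubgroup UNIV b \<subseteq> p" "a \<notin> p"
        using prime_not_containing[OF principal_lsubgroup_convex] by blast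
      then show False using that principal_lsubgroup_self[of b] by (auto simp: Spec_U_def)
    qed
    ultimately show ?thesis
      using principal_lsubgroup_subset_iff[OF principal_lsubgroup_convex] by blast
  qed
  then show ?thesis by (metis order.antisym order_refl)
qed

section \<open>The hull-kernel and patch topologies\<close>

text \<open>A generating family closed under binary intersections is a base; the hypothesis handles
  the intersection case of the induction.\<close>

lemma openin_topology_generated_by_base:
  assumes "\<And>A B. A \<in> \<B> \<Longrightarrow> B \<in> \<B> \<Longrightarrow> A \<inter> B \<in> \<B>"
  shows "openin (topology_generated_by \<B>) W \<longleftrightarrow> (\<forall>x\<in>W. \<exists>B\<in>\<B>. x \<in> B \<and> B \<subseteq> W)"
proof
  assume "openin (topology_generated_by \<B>) W"
  then have "generate_topology_on \<B> W" by (simp add: openin_topology_generated_by_iff)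
  then show "\<forall>x\<in>W. \<exists>B\<in>\<B>. x \<in> B \<and> B \<subseteq> W"
  proof induction
    case (Int A B)
    show ?case
    proof
      fix x assume "x \<in> A \<inter> B"
      then obtain A' B' where "A' \<in> \<B>" "x \<in> A'" "A' \<subseteq> A" "B' \<in> \<B>" "x \<in> B'" "B' \<subseteq> B"
        using Int.IH by blast
      then show "\<exists>C\<in>\<B>. x \<in> C \<and> C \<subseteq> A \<inter> B"
        using assms by (intro bexI[of _ "A' \<inter> B'"]) auto
    qed
  next
    case (UN K)
    then show ?case by (meson Union_iff Union_upper order_trans)
  qed auto
next
  assume "\<forall>x\<in>W. \<exists>B\<in>\<B>. x \<in> B \<and> B \<subseteq> W"
  then have "W = \<Union>{B \<in> \<B>. B \<subseteq> W}" by blast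
  moreover have "openin (topology_generated_by \<B>) (\<Union>{B \<in> \<B>. B \<subseteq> W})"
    by (intro openin_Union) (auto intro: topology_generated_by_Basis)
  ultimately show "openin (topology_generated_by \<B>) W" by simp
qed

lemma Spec_U_Int: "Spec_U UNIV a \<inter> Spec_U UNIV b = Spec_U UNIV (inf (lg_abs a) (lg_abs b))"
  by (auto simp: Spec_U_def Spec_inf_iff)

lemma Spec_U_Un: "Spec_U UNIV a \<union> Spec_U UNIV b = Spec_U UNIV (sup (lg_abs a) (lg_abs b))"
  by (auto simp: Spec_U_def Spec_sup_iff)

lemma Spec_V_Int: "Spec_V UNIV a \<inter> Spec_V UNIV b = Spec_V UNIV (sup (lg_abs a) (lg_abs b))"
  by (auto simp: Spec_V_def Spec_sup_iff)

lemma Spec_U_zero: "Spec_U UNIV 0 = {}"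
  by (auto simp: Spec_U_def dest: Spec_convex intro: convex_lsubgroup_zero)

lemma Spec_V_zero: "Spec_V UNIV 0 = Spec UNIV"
  by (auto simp: Spec_V_def dest: Spec_convex intro: convex_lsubgroup_zero)

lemma Spec_U_eq_empty_iff: "Spec_U UNIV a = {} \<longleftrightarrow> a = 0"
proof
  assume "Spec_U UNIV a = {}"
  then show "a = 0"
    using prime_not_containing[OF convex_lsubgroup_singleton_zero, of a] by (auto simp: Spec_U_def)
qed (simp add: Spec_U_zero)

lemma openin_hull_kernel:
  "openin (hull_kernel_topology UNIV) W \<longleftrightarrow> (\<forall>p\<in>W. \<exists>a. p \<in> Spec_U UNIV a \<and> Spec_U UNIV a \<subseteq> W)"
proof -
  let ?B = "{Spec_U UNIV a | a. a \<in> UNIV}"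
  have "A \<inter> B \<in> ?B" if "A \<in> ?B" "B \<in> ?B" for A B :: "'a set set"
    using that Spec_U_Int by blast
  then have "openin (hull_kernel_topology UNIV) W \<longleftrightarrow> (\<forall>p\<in>W. \<exists>B\<in>?B. p \<in> B \<and> B \<subseteq> W)"
    unfolding hull_kernel_topology_def by (rule openin_topology_generated_by_base)
  moreover have "(\<exists>B\<in>?B. P B) \<longleftrightarrow> (\<exists>a. P (Spec_U UNIV a))" for P :: "'a set set \<Rightarrow> bool"
    by auto
  ultimately show ?thesis by simp
qed

lemma openin_patch:
  "openin (patch_topology UNIV) W \<longleftrightarrow>
     (\<forall>p\<in>W. \<exists>a b. p \<in> Spec_U UNIV a \<inter> Spec_V UNIV b \<and> Spec_U UNIV a \<inter> Spec_V UNIV b \<subseteq> W)"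
proof -
  let ?B = "{Spec_U UNIV a \<inter> Spec_V UNIV b | a b. a \<in> UNIV \<and> b \<in> UNIV}"
  have "A \<inter> B \<in> ?B" if "A \<in> ?B" "B \<in> ?B" for A B :: "'a set set"
  proof -
    obtain a b c d where "A = Spec_U UNIV a \<inter> Spec_V UNIV b" "B = Spec_U UNIV c \<inter> Spec_V UNIV d"
      using \<open>A \<in> ?B\<close> \<open>B \<in> ?B\<close> by blast
    then have "A \<inter> B = (Spec_U UNIV a \<inter> Spec_U UNIV c) \<inter> (Spec_V UNIV b \<inter> Spec_V UNIV d)" by blast
    then show ?thesis unfolding Spec_U_Int Spec_V_Int by blast
  qed
  then have "openin (patch_topology UNIV) W \<longleftrightarrow> (\<forall>p\<in>W. \<exists>B\<in>?B. p \<in> B \<and> B \<subseteq> W)"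
    unfolding patch_topology_def by (rule openin_topology_generated_by_base)
  moreover have "(\<exists>B\<in>?B. P B) \<longleftrightarrow> (\<exists>a b. P (Spec_U UNIV a \<inter> Spec_V UNIV b))"
    for P :: "'a set set \<Rightarrow> bool"
    by auto
  ultimately show ?thesis by simp
qed

lemma topspace_hull_kernel: "topspace (hull_kernel_topology UNIV) = Spec UNIV"
  unfolding hull_kernel_topology_def topology_generated_by_topspace
  by (auto simp: Spec_U_def Spec_def)

lemma topspace_patch: "topspace (patch_topology UNIV) = Spec UNIV"
proof -
  have "p \<in> \<Union>{Spec_U UNIV a \<inter> Spec_V UNIV b | a b. a \<in> UNIV \<and> b \<in> UNIV}" if p: "p \<in> Spec UNIV" for p :: "'a set"
  proof -
    \<comment> \<open>Properness of \<open>p\<close> provides \<open>a\<close>, and V(0) is the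
      whole spectrum.\<close>
    obtain a where "a \<notin> p" using p by (auto simp: Spec_def)
    then have "p \<in> Spec_U UNIV a \<inter> Spec_V UNIV 0" using p by (simp add: Spec_U_def Spec_V_zero)
    then show ?thesis by blast
  qed
  then show ?thesis
    unfolding patch_topology_def topology_generated_by_topspace by (auto simp: Spec_U_def)
qed

lemma openin_Spec_U: "openin (hull_kernel_topology UNIV) (Spec_U UNIV a)"
  by (auto simp: openin_hull_kernel)

text \<open>
  The elements \<open>x\<close> for which \<open>U(x)\<close> is covered by finitely many members of a given open cover of
  \<open>U(a)\<close> form a convex \<open>\<ell>\<close>-subgroup; a prime containing it but not \<open>a\<close> would be left uncovered.
\<close>

lemma compactin_Spec_U: "compactin (hull_kernel_topology UNIV) (Spec_U UNIV a)"
  unfolding compactin_def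
proof (intro conjI allI impI)
  show "Spec_U UNIV a \<subseteq> topspace (hull_kernel_topology UNIV)"
    by (auto simp: topspace_hull_kernel Spec_U_def)
  fix \<U> assume U: "Ball \<U> (openin (hull_kernel_topology UNIV)) \<and> Spec_U UNIV a \<subseteq> \<Union>\<U>"
  define H where "H = {x. \<exists>\<F>. finite \<F> \<and> \<F> \<subseteq> \<U> \<and> Spec_U UNIV x \<subseteq> \<Union>\<F>}"
  have H: "H \<in> convex_lsubgroups UNIV"
  proof (rule convex_lsubgroupI)
    show "0 \<in> H" by (auto simp: H_def Spec_U_zero intro!: exI[of _ "{}"])
  next
    fix x z assume "x \<in> H" "lg_abs z \<le> lg_abs x"
    moreover from this have "Spec_U UNIV z \<subseteq> Spec_U UNIV x"
      using convex_lsubgroup_solid[OF Spec_convex] by (auto simp: Spec_U_def)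
    ultimately show "z \<in> H" unfolding H_def by (blast intro: order_trans)
  next
    fix x y assume "x \<in> H" "y \<in> H"
    then obtain \<F> \<G> where "finite \<F>" "\<F> \<subseteq> \<U>" "Spec_U UNIV x \<subseteq> \<Union>\<F>"
      "finite \<G>" "\<G> \<subseteq> \<U>" "Spec_U UNIV y \<subseteq> \<Union>\<G>" by (auto simp: H_def)
    moreover have "Spec_U UNIV (x + y) \<subseteq> Spec_U UNIV x \<union> Spec_U UNIV y"
      using convex_lsubgroup_add[OF Spec_convex] by (auto simp: Spec_U_def)
    ultimately show "x + y \<in> H"
      unfolding H_def by (intro CollectI exI[of _ "\<F> \<union> \<G>"]) auto
  qed
  have "a \<in> H"
  proof (rule ccontr)
    assume "a \<notin> H"
    then obtain p where p: "p \<in> Spec UNIV" "H \<subseteq> p" "a \<notin> p" using prime_not_containing[OF H] by blast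
    then obtain W where W: "W \<in> \<U>" "p \<in> W" using U by (auto simp: Spec_U_def)
    then obtain b where b: "p \<in> Spec_U UNIV b" "Spec_U UNIV b \<subseteq> W"
      using U unfolding openin_hull_kernel by blast
    \<comment> \<open>The single set \<open>W\<close> covers U(b).\<close>
    then have "b \<in> H" using W by (auto simp: H_def intro!: exI[of _ "{W}"])
    then show False using p b by (auto simp: Spec_U_def)
  qed
  then show "\<exists>\<F>. finite \<F> \<and> \<F> \<subseteq> \<U> \<and> Spec_U UNIV a \<subseteq> \<Union>\<F>" by (simp add: H_def)
qed

text \<open>Compactness leaves a finite union of basic sets, which collapses to one because U(b)
  \<union> U(c) = U(\<bar>b\<bar> \<or> \<bar>c\<bar>); the empty union is U(0).\<close>

lemma compact_open_eq_Spec_U: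
  assumes "openin (hull_kernel_topology UNIV) K" "compactin (hull_kernel_topology UNIV) K"
  obtains a where "K = Spec_U UNIV a"
proof -
  let ?B = "{Spec_U UNIV a | a. Spec_U UNIV a \<subseteq> K}"
  have "K \<subseteq> \<Union>?B" using assms(1) unfolding openin_hull_kernel by blast
  moreover have "Ball ?B (openin (hull_kernel_topology UNIV))" by (auto simp: openin_Spec_U)
  ultimately obtain \<F> where F: "finite \<F>" "\<F> \<subseteq> ?B" "K \<subseteq> \<Union>\<F>"
    using assms(2) unfolding compactin_def by meson
  have "\<exists>a. \<Union>\<F> = Spec_U UNIV a"
    using F(1,2)
  proof induction
    case empty
    show ?case using Spec_U_zero by auto
  next
    case (insert A \<F>)
    then obtain b c where "A = Spec_U UNIV b" "\<Union>\<F> = Spec_U UNIV c" by blast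
    then show ?case using Spec_U_Un[of b c] by auto
  qed
  moreover have "K = \<Union>\<F>" using F by blast
  ultimately show ?thesis using that by blast
qed

text \<open>A basic neighbourhood U(c) of \<open>p\<close> fails to meet U(a) exactly when
  \<open>c\<close> is disjoint from \<open>a\<close>, so \<open>p\<close> is in the closure iff no
  \<open>c \<notin> p\<close> lies in the polar of \<open>a\<close>.\<close>

lemma closure_of_Spec_U:
  "hull_kernel_topology UNIV closure_of Spec_U UNIV a = {p \<in> Spec UNIV. perp UNIV {a} \<subseteq> p}"
proof (intro equalityI subsetI)
  fix p assume p: "p \<in> hull_kernel_topology UNIV closure_of Spec_U UNIV a"
  have "c \<in> p" if "c \<in> perp UNIV {a}" for c
  proof (rule ccontr)
    assume "c \<notin> p"
    moreover have "p \<in> Spec UNIV" using p by (simp add: in_closure_of topspace_hull_kernel)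
    ultimately have "p \<in> Spec_U UNIV c" by (simp add: Spec_U_def)
    then have "Spec_U UNIV a \<inter> Spec_U UNIV c \<noteq> {}"
      using p openin_Spec_U[of c] unfolding in_closure_of by blast
    then show False
      using that by (simp add: Spec_U_Int Spec_U_eq_empty_iff mem_perp_singleton inf_commute)
  qed
  then show "p \<in> {p \<in> Spec UNIV. perp UNIV {a} \<subseteq> p}"
    using p by (auto simp: in_closure_of topspace_hull_kernel)
next
  fix p assume p: "p \<in> {p \<in> Spec UNIV. perp UNIV {a} \<subseteq> p}"
  have "\<exists>q. q \<in> Spec_U UNIV a \<and> q \<in> T" if T: "p \<in> T" "openin (hull_kernel_topology UNIV) T" for T
  proof -
    obtain c where c: "p \<in> Spec_U UNIV c" "Spec_U UNIV c \<subseteq> T" using T by (auto simp: openin_hull_kernel)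
    then have "c \<notin> perp UNIV {a}" using p by (auto simp: Spec_U_def)
    then have "Spec_U UNIV a \<inter> Spec_U UNIV c \<noteq> {}"
      by (simp add: Spec_U_Int Spec_U_eq_empty_iff mem_perp_singleton inf_commute)
    then show ?thesis using c by blast
  qed
  then show "p \<in> hull_kernel_topology UNIV closure_of Spec_U UNIV a"
    using p by (simp add: in_closure_of topspace_hull_kernel)
qed

text \<open>The polar is recovered from the closure as the intersection of its members.\<close>

lemma closure_of_Spec_U_eq_iff:
  "hull_kernel_topology UNIV closure_of Spec_U UNIV a = hull_kernel_topology UNIV closure_of Spec_U UNIV b
     \<longleftrightarrow> perp UNIV {a} = perp UNIV {b}"
proof
  have "perp UNIV {a} = \<Inter> {p \<in> Spec UNIV. perp UNIV {a} \<subseteq> p}" for a :: 'a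
    using prime_not_containing[OF perp_convex_lsubgroup[of "{a}"]] by blast
  then show "perp UNIV {a} = perp UNIV {b}"
    if "hull_kernel_topology UNIV closure_of Spec_U UNIV a = hull_kernel_topology UNIV closure_of Spec_U UNIV b"
    using that unfolding closure_of_Spec_U by metis
qed (simp add: closure_of_Spec_U)

section \<open>The Martinez property\<close>

text \<open>The forward direction uses the generator itself. Conversely, the double polar of any
  \<open>x\<close> in a double polar stays inside it, as taking the double polar is
  idempotent.\<close>

lemma principal_d_element_iff:
  "d_element UNIV (principal_lsubgroup UNIV a) \<longleftrightarrow>
     principal_lsubgroup UNIV a = perp UNIV (perp UNIV {a})"
proof
  assume "d_element UNIV (principal_lsubgroup UNIV a)"
  then show "principal_lsubgroup UNIV a = perp UNIV (perp UNIV {a})"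
    using principal_lsubgroup_self principal_lsubgroup_subset_perp_perp
    unfolding d_element_def by blast
next
  assume eq: "principal_lsubgroup UNIV a = perp UNIV (perp UNIV {a})"
  have "perp UNIV (perp UNIV {x}) \<subseteq> principal_lsubgroup UNIV a" if "x \<in> principal_lsubgroup UNIV a" for x
  proof -
    have "perp UNIV (perp UNIV {x}) \<subseteq> perp UNIV (perp UNIV (perp UNIV (perp UNIV {a})))"
      using that eq by (intro perp_antimono) blast
    then show ?thesis by (simp add: eq perp_perp_perp)
  qed
  then show "d_element UNIV (principal_lsubgroup UNIV a)"
    by (simp add: d_element_def principal_lsubgroup_convex)
qed

lemma martinez_iff_principal:
  "martinez (UNIV :: 'a::lgroup_add set) \<longleftrightarrow> (\<forall>a :: 'a. principal_lsubgroup UNIV a = perp UNIV (perp UNIV {a}))"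
proof
  assume "martinez (UNIV :: 'a set)"
  then show "\<forall>a :: 'a. principal_lsubgroup UNIV a = perp UNIV (perp UNIV {a})"
    by (simp add: martinez_def principal_lsubgroup_convex flip: principal_d_element_iff)
next
  assume "\<forall>a :: 'a. principal_lsubgroup UNIV a = perp UNIV (perp UNIV {a})"
  then show "martinez (UNIV :: 'a set)"
    unfolding martinez_def d_element_def using principal_lsubgroup_subset_iff by blast
qed

text \<open>If some \<open>H\<close> failed to be a d-element, a prime above \<open>H\<close>
  missing the offending \<open>h\<close> would fail too.\<close>

lemma martinez_iff_Spec_d: "martinez (UNIV :: 'a::lgroup_add set) \<longleftrightarrow> Spec_d (UNIV :: 'a set) = Spec UNIV"
proof
  assume "martinez (UNIV :: 'a set)"
  then show "Spec_d (UNIV :: 'a set) = Spec UNIV"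
    by (auto simp: Spec_d_def martinez_def dest: Spec_convex)
next
  assume eq: "Spec_d (UNIV :: 'a set) = Spec UNIV"
  have "h \<in> H" if H: "H \<in> convex_lsubgroups UNIV" "a \<in> H" "h \<in> perp UNIV (perp UNIV {a})" for H and a h :: 'a
  proof (rule ccontr)
    assume "h \<notin> H"
    then obtain p where p: "p \<in> Spec UNIV" "H \<subseteq> p" "h \<notin> p" using prime_not_containing[OF H(1)] by blast
    then have "d_element UNIV p" using eq by (auto simp: Spec_d_def)
    then show False using p H by (auto simp: d_element_def)
  qed
  then show "martinez (UNIV :: 'a set)" by (auto simp: martinez_def d_element_def)
qed

section \<open>Passage to convex subgroups as carriers\<close>

text \<open>An element between two members of \<open>K\<close> lies in \<open>H\<close> by convexity
  of \<open>H\<close>, and then in \<open>K\<close> by convexity of \<open>K\<close> within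
  \<open>H\<close>.\<close>

lemma convex_lsubgroups_subset:
  assumes "H \<in> convex_lsubgroups UNIV"
  shows "convex_lsubgroups H \<subseteq> convex_lsubgroups UNIV"
proof
  fix K assume K: "K \<in> convex_lsubgroups H"
  show "K \<in> convex_lsubgroups UNIV"
  proof (rule convex_lsubgroups_memI)
    fix x y z assume "x \<le> z" "z \<le> y" "x \<in> K" "y \<in> K"
    moreover from this have "z \<in> H"
      using convex_lsubgroupD(1)[OF K] by (metis convex_lsubgroupD(7)[OF assms _ _ UNIV_I] subsetD)
    ultimately show "z \<in> K" by (metis convex_lsubgroupD(7)[OF K])
  qed (simp_all add: convex_lsubgroupD(2-6)[OF K])
qed

lemma convex_lsubgroup_Int:
  assumes "H \<in> convex_lsubgroups UNIV" "K \<in> convex_lsubgroups UNIV"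
  shows "K \<inter> H \<in> convex_lsubgroups H"
proof (rule convex_lsubgroups_memI)
  fix x y z assume "x \<le> z" "z \<le> y" "x \<in> K \<inter> H" "y \<in> K \<inter> H" "z \<in> H"
  then show "z \<in> K \<inter> H" by (metis Int_iff convex_lsubgroupD(7)[OF assms(2) _ _ UNIV_I])
qed (simp_all add: convex_lsubgroupD(2-6)[OF assms(1)] convex_lsubgroupD(2-6)[OF assms(2)])

text \<open>If \<open>k \<bottom> a\<close> and \<open>h \<in> H\<close>, then \<open>\<bar>h\<bar> \<and> \<bar>k\<bar>\<close> lies in the polar of \<open>a\<close> relative to \<open>H\<close>.\<close>

lemma perp_perp_relative:
  assumes H: "H \<in> convex_lsubgroups UNIV"
  shows "perp H (perp H {a}) = H \<inter> perp UNIV (perp UNIV {a})"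
proof (intro equalityI subsetI)
  fix h assume h: "h \<in> perp H (perp H {a})"
  then have "h \<in> H" by (simp add: perp_def)
  have "inf (lg_abs h) (lg_abs k) = 0" if k: "inf (lg_abs k) (lg_abs a) = 0" for k
  proof -
    let ?m = "inf (lg_abs h) (lg_abs k)"
    have "?m \<in> H" using convex_lsubgroup_solid[OF H \<open>h \<in> H\<close>] by simp
    moreover have "inf ?m (lg_abs a) = 0"
      using k by (simp add: inf_assoc inf_absorb2 lg_abs_nonneg)
    ultimately have "?m \<in> perp H {a}" by (simp add: perp_def)
    then have "inf (lg_abs h) (lg_abs ?m) = 0" using h unfolding perp_def by blast
    then show ?thesis by simp
  qed
  then show "h \<in> H \<inter> perp UNIV (perp UNIV {a})" using \<open>h \<in> H\<close> by (simp add: perp_def)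
qed (auto simp: perp_def)

lemma martinez_convex_lsubgroup:
  assumes "martinez (UNIV :: 'a::lgroup_add set)" "H \<in> convex_lsubgroups (UNIV :: 'a set)"
  shows "martinez H"
  unfolding martinez_def d_element_def perp_perp_relative[OF assms(2)]
proof (intro ballI conjI)
  fix K a assume "K \<in> convex_lsubgroups H" "a \<in> K"
  then have "perp UNIV (perp UNIV {a}) \<subseteq> K"
    using assms(1) convex_lsubgroups_subset[OF assms(2)] by (auto simp: martinez_def d_element_def)
  then show "H \<inter> perp UNIV (perp UNIV {a}) \<subseteq> K" by (rule le_infI2)
qed

text \<open>The property is local: \<open>a\<close> and \<open>h\<close> both lie in the principal
  subgroup of \<bar>a\<bar> \<or> \<bar>h\<bar>, where the trace of \<open>H\<close> is a d-element
  and relative double polars are traces of absolute ones.\<close>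

lemma martinez_if_principal:
  assumes "\<forall>a :: 'a::lgroup_add. martinez (principal_lsubgroup UNIV a)"
  shows "martinez (UNIV :: 'a set)"
proof -
  have "h \<in> H" if H: "H \<in> convex_lsubgroups UNIV" "a \<in> H" "h \<in> perp UNIV (perp UNIV {a})" for H and a h :: 'a
  proof -
    define c where "c = sup (lg_abs a) (lg_abs h)"
    let ?C = "principal_lsubgroup UNIV c"
    have "lg_abs a \<le> lg_abs c" "lg_abs h \<le> lg_abs c"
      by (simp_all add: c_def)
    then have "a \<in> ?C" "h \<in> ?C"
      using convex_lsubgroup_solid[OF principal_lsubgroup_convex principal_lsubgroup_self] by blast+
    moreover have "d_element ?C (H \<inter> ?C)"
      using assms convex_lsubgroup_Int[OF principal_lsubgroup_convex H(1)] by (simp add: martinez_def)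
    ultimately have "perp ?C (perp ?C {a}) \<subseteq> H \<inter> ?C"
      using H(2) by (simp add: d_element_def)
    then show ?thesis
      using \<open>h \<in> ?C\<close> H(3) unfolding perp_perp_relative[OF principal_lsubgroup_convex] by blast
  qed
  then show ?thesis by (auto simp: martinez_def d_element_def)
qed

section \<open>Reduction of the remaining conditions to principal subgroups and double
  polars\<close>

text \<open>In terms of generators, the element required by disjunctivity is some \<open>k\<close>
  disjoint from \<open>a\<close> but not from \<open>h\<close>, which is exactly a witness that
  \<open>h\<close> is outside the double polar of \<open>a\<close>.\<close>

lemma disjunctive_iff_principal:
  "disjunctive (principal_lsubgroups (UNIV :: 'a::lgroup_add set)) (\<subseteq>) (\<inter>) {0} \<longleftrightarrow>
     (\<forall>a :: 'a. principal_lsubgroup UNIV a = perp UNIV (perp UNIV {a}))"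
proof -
  have *: "h \<notin> perp UNIV (perp UNIV {a}) \<longleftrightarrow>
      (\<exists>k. inf (lg_abs h) (lg_abs k) \<noteq> 0 \<and> inf (lg_abs a) (lg_abs k) = 0)" for h a :: 'a
    by (auto simp: mem_perp inf_commute)
  have "disjunctive (principal_lsubgroups (UNIV :: 'a set)) (\<subseteq>) (\<inter>) {0} \<longleftrightarrow>
     (\<forall>h a :: 'a. h \<notin> principal_lsubgroup UNIV a \<longrightarrow> h \<notin> perp UNIV (perp UNIV {a}))"
    unfolding disjunctive_def principal_lsubgroups_def
    by (simp add: principal_lsubgroup_subset_iff principal_lsubgroup_convex
        principal_lsubgroup_Int_eq_zero_iff *)
  then show ?thesis using principal_lsubgroup_subset_perp_perp by blast
qed

text \<open>For \<open>h\<close> in the double polar of \<open>a\<close>, the element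
  \<open>c\<close> = \<bar>a\<bar> \<or> \<bar>h\<bar> has the same polar as \<open>a\<close>, hence
  generates the same subgroup, which therefore contains \<open>h\<close>.\<close>

lemma principal_iff_determined_by_polar:
  "(\<forall>a :: 'a::lgroup_add. principal_lsubgroup UNIV a = perp UNIV (perp UNIV {a})) \<longleftrightarrow>
     (\<forall>a b :: 'a. principal_lsubgroup UNIV a = principal_lsubgroup UNIV b \<longleftrightarrow>
        perp UNIV (perp UNIV {a}) = perp UNIV (perp UNIV {b}))" (is "?P \<longleftrightarrow> ?Q")
proof
  assume ?Q
  have "h \<in> principal_lsubgroup UNIV a" if h: "h \<in> perp UNIV (perp UNIV {a})" for h a :: 'a
  proof -
    define c where "c = sup (lg_abs a) (lg_abs h)"
    have "principal_lsubgroup UNIV a = principal_lsubgroup UNIV c"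
      using \<open>?Q\<close> perp_singleton_sup[OF h] by (simp add: c_def)
    moreover have "lg_abs h \<le> lg_abs c" by (simp add: c_def)
    ultimately show ?thesis
      using convex_lsubgroup_solid[OF principal_lsubgroup_convex principal_lsubgroup_self] by blast
  qed
  then show ?P using principal_lsubgroup_subset_perp_perp by blast
qed simp

lemma distinct_closures_iff:
  fixes X :: "'a::lgroup_add set topology"
  assumes "X = hull_kernel_topology UNIV"
  shows "(\<forall>K L. openin X K \<and> compactin X K \<and> openin X L \<and> compactin X L \<and> K \<noteq> L \<longrightarrow>
        X closure_of K \<noteq> X closure_of L) \<longleftrightarrow>
     (\<forall>a b :: 'a. principal_lsubgroup UNIV a = principal_lsubgroup UNIV b \<longleftrightarrow>
        perp UNIV (perp UNIV {a}) = perp UNIV (perp UNIV {b}))" (is "?P \<longleftrightarrow> ?Q")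
proof -
  have "?P \<longleftrightarrow> (\<forall>a b. Spec_U UNIV a \<noteq> Spec_U UNIV b \<longrightarrow>
      X closure_of Spec_U UNIV a \<noteq> X closure_of Spec_U UNIV b)" (is "_ \<longleftrightarrow> ?R")
  proof
    assume ?P
    then show ?R unfolding assms using openin_Spec_U compactin_Spec_U by blast
  next
    assume R: ?R
    show ?P
    proof (intro allI impI, elim conjE)
      fix K L assume KL: "openin X K" "compactin X K" "openin X L" "compactin X L" "K \<noteq> L"
      obtain a b where "K = Spec_U UNIV a" "L = Spec_U UNIV b"
        using KL compact_open_eq_Spec_U unfolding assms by metis
      then show "X closure_of K \<noteq> X closure_of L" using R KL(5) by blast
    qed
  qed
  \<comment> \<open>Equal sets trivially have equal closures, so injectivity of closure can be
    stated as an equivalence.\<close>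
  also have "\<dots> \<longleftrightarrow> (\<forall>a b :: 'a. Spec_U UNIV a = Spec_U UNIV b \<longleftrightarrow>
      X closure_of Spec_U UNIV a = X closure_of Spec_U UNIV b)"
    by metis
  also have "\<dots> \<longleftrightarrow> ?Q"
    unfolding assms closure_of_Spec_U_eq_iff principal_lsubgroup_eq_iff_Spec_U
    unfolding perp_singleton_eq_iff ..
  finally show ?thesis .
qed

lemma basic_patch_open_nonempty_iff:
  "Spec_U UNIV a \<inter> Spec_V UNIV b \<noteq> {} \<longleftrightarrow> a \<notin> principal_lsubgroup UNIV b"
proof
  assume "Spec_U UNIV a \<inter> Spec_V UNIV b \<noteq> {}"
  then obtain p where "p \<in> Spec UNIV" "a \<notin> p" "b \<in> p" by (auto simp: Spec_U_def Spec_V_def)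
  then show "a \<notin> principal_lsubgroup UNIV b"
    using principal_lsubgroup_subset_iff[OF Spec_convex] by blast
next
  assume "a \<notin> principal_lsubgroup UNIV b"
  then obtain p where "p \<in> Spec UNIV" "principal_lsubgroup UNIV b \<subseteq> p" "a \<notin> p"
    using prime_not_containing[OF principal_lsubgroup_convex] by blast
  then show "Spec_U UNIV a \<inter> Spec_V UNIV b \<noteq> {}"
    using principal_lsubgroup_self[of b] by (auto simp: Spec_U_def Spec_V_def)
qed

lemma minimal_prime_in_basic_patch_open_iff:
  "Spec_U UNIV a \<inter> Spec_V UNIV b \<inter> Min_Spec UNIV \<noteq> {} \<longleftrightarrow> a \<notin> perp UNIV (perp UNIV {b})"
  unfolding perp_perp_eq_Inter_minimal_primes by (auto simp: Spec_U_def Spec_V_def Min_Spec_def)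

text \<open>Density is tested on the basic sets U(a) \<inter> V(b): being nonempty and containing a
  minimal prime are expressed by the two preceding criteria.\<close>

lemma minimal_primes_dense_iff:
  "patch_topology (UNIV :: 'a::lgroup_add set) closure_of Min_Spec UNIV = Spec UNIV \<longleftrightarrow>
     (\<forall>a :: 'a. principal_lsubgroup UNIV a = perp UNIV (perp UNIV {a}))"
proof -
  have "patch_topology (UNIV :: 'a set) closure_of Min_Spec UNIV = Spec UNIV \<longleftrightarrow>
     (\<forall>W. openin (patch_topology (UNIV :: 'a set)) W \<and> W \<noteq> {} \<longrightarrow> Min_Spec UNIV \<inter> W \<noteq> {})"
    unfolding topspace_patch[symmetric] by (rule dense_intersects_open)
  also have "\<dots> \<longleftrightarrow> (\<forall>a b :: 'a. Spec_U UNIV a \<inter> Spec_V UNIV b \<noteq> {} \<longrightarrow>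
      Spec_U UNIV a \<inter> Spec_V UNIV b \<inter> Min_Spec UNIV \<noteq> {})" (is "?L \<longleftrightarrow> ?R")
  proof
    show ?R if ?L
      using that openin_patch by (metis inf_commute order_refl)
    show ?L if R: ?R
    proof (intro allI impI)
      fix W assume "openin (patch_topology (UNIV :: 'a set)) W \<and> W \<noteq> {}"
      then obtain a b :: 'a where ab: "Spec_U UNIV a \<inter> Spec_V UNIV b \<noteq> {}"
          "Spec_U UNIV a \<inter> Spec_V UNIV b \<subseteq> W"
        unfolding openin_patch by blast
      then show "Min_Spec UNIV \<inter> W \<noteq> {}" using R by blast
    qed
  qed
  also have "\<dots> \<longleftrightarrow> (\<forall>a :: 'a. principal_lsubgroup UNIV a = perp UNIV (perp UNIV {a}))"
    unfolding basic_patch_open_nonempty_iff minimal_prime_in_basic_patch_open_iff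
    using principal_lsubgroup_subset_perp_perp by blast
  finally show ?thesis .
qed

lemma pi_base_iff:
  "pi_base (patch_topology (UNIV :: 'a::lgroup_add set)) {Spec_U UNIV a | a. a \<in> UNIV \<and> 0 < a} \<longleftrightarrow>
     (\<forall>a :: 'a. principal_lsubgroup UNIV a = perp UNIV (perp UNIV {a}))" (is "?L \<longleftrightarrow> ?R")
proof
  assume L: ?L
  have "h \<in> principal_lsubgroup UNIV b" if h: "h \<in> perp UNIV (perp UNIV {b})" for h b :: 'a
  proof (rule ccontr)
    assume "h \<notin> principal_lsubgroup UNIV b"
    then have ne: "Spec_U UNIV h \<inter> Spec_V UNIV b \<noteq> {}" by (simp add: basic_patch_open_nonempty_iff)
    have op: "openin (patch_topology UNIV) (Spec_U UNIV h \<inter> Spec_V UNIV b)"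
      unfolding openin_patch by blast
    obtain c where c: "0 < c" "Spec_U UNIV c \<subseteq> Spec_U UNIV h \<inter> Spec_V UNIV b"
      using L[unfolded pi_base_def, THEN conjunct2, rule_format, OF conjI[OF op ne]] by auto
    \<comment> \<open>As \<open>c\<close> is nonzero, U(c) contains a minimal prime; it lies in U(h)
      \<inter> V(b), which is impossible for \<open>h\<close> in the double polar of
      \<open>b\<close>.\<close>
    obtain p where "p \<in> Min_Spec UNIV" "c \<notin> p"
      using minimal_prime_not_containing[of c] c(1) by blast
    then have "p \<in> Spec_U UNIV h \<inter> Spec_V UNIV b \<inter> Min_Spec UNIV"
      using c(2) by (auto simp: Spec_U_def Min_Spec_def)
    then show False using h minimal_prime_in_basic_patch_open_iff by blast
  qed
  then show ?R using principal_lsubgroup_subset_perp_perp by blast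
next
  assume R: ?R
  have "openin (patch_topology UNIV) (Spec_U UNIV a)" for a :: 'a
  proof -
    have "Spec_U UNIV a = Spec_U UNIV a \<inter> Spec_V UNIV 0"
      by (auto simp: Spec_V_zero Spec_U_def)
    then show ?thesis unfolding openin_patch by blast
  qed
  moreover have *: "\<exists>c. 0 < c \<and> Spec_U UNIV c \<subseteq> W"
    if W: "openin (patch_topology (UNIV :: 'a set)) W" "W \<noteq> {}" for W
  proof -
    obtain a b :: 'a where ab: "Spec_U UNIV a \<inter> Spec_V UNIV b \<noteq> {}"
        "Spec_U UNIV a \<inter> Spec_V UNIV b \<subseteq> W"
      using W unfolding openin_patch by blast
    then have "a \<notin> perp UNIV (perp UNIV {b})"
      using R by (simp add: basic_patch_open_nonempty_iff)
    then obtain k where k: "inf (lg_abs k) (lg_abs b) = 0" "inf (lg_abs a) (lg_abs k) \<noteq> 0"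
      by (auto simp: mem_perp)
    \<comment> \<open>A prime missing \<open>k\<close> contains \<open>b\<close>, since the two are
      disjoint.\<close>
    have "Spec_U UNIV (inf (lg_abs a) (lg_abs k)) \<subseteq> Spec_U UNIV a \<inter> Spec_V UNIV b"
      unfolding Spec_U_Int[symmetric] using Spec_disjoint[OF _ k(1)]
      by (auto simp: Spec_U_def Spec_V_def)
    moreover have "0 < inf (lg_abs a) (lg_abs k)"
      using k(2) by (simp add: order.strict_iff_order lg_abs_nonneg)
    ultimately show ?thesis using ab by blast
  qed
  ultimately show ?L
    unfolding pi_base_def
  proof (intro conjI allI impI ballI)
    fix W assume W: "openin (patch_topology (UNIV :: 'a set)) W \<and> W \<noteq> {}"
    then obtain c :: 'a where "0 < c" "Spec_U UNIV c \<subseteq> W" using * by blast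
    then show "\<exists>V\<in>{Spec_U UNIV a | a. a \<in> UNIV \<and> 0 < a}. V \<subseteq> W" by blast
  qed (auto simp: Spec_U_eq_empty_iff)
qed

theorem theorem4p1:
  fixes G :: "'a::lgroup_add set"
  assumes "G = UNIV"
  shows "all_equivalent
    [disjunctive (principal_lsubgroups G) (\<subseteq>) (\<inter>) {0},
     martinez G,
     Spec_d G = Spec G,
     \<forall>a\<in>G. principal_lsubgroup G a = perp G (perp G {a}),
     \<forall>a\<in>G. d_element G (principal_lsubgroup G a),
     patch_topology G closure_of Min_Spec G = Spec G,
     pi_base (patch_topology G) {Spec_U G a | a. a \<in> G \<and> 0 < a},
     \<forall>K L. openin (hull_kernel_topology G) K \<and> compactin (hull_kernel_topology G) K \<and>
        openin (hull_kernel_topology G) L \<and> compactin (hull_kernel_topology G) L \<and> K \<noteq> L \<longrightarrow>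
        hull_kernel_topology G closure_of K \<noteq> hull_kernel_topology G closure_of L,
     \<forall>a\<in>G. martinez (principal_lsubgroup G a),
     \<forall>H\<in>convex_lsubgroups G. martinez H,
     \<forall>a\<in>G. principal_lsubgroup G a = G \<inter> \<Inter> {p \<in> Min_Spec G. a \<in> p},
     \<forall>a\<in>G. \<forall>b\<in>G. principal_lsubgroup G a = principal_lsubgroup G b \<longleftrightarrow> perp G (perp G {a}) = perp G (perp G {b})]"
proof -
  have H: "(\<forall>H\<in>convex_lsubgroups (UNIV :: 'a set). martinez H) \<longleftrightarrow> martinez (UNIV :: 'a set)" (is "?L \<longleftrightarrow> ?R")
  proof
    assume ?L
    then have "martinez (principal_lsubgroup UNIV a)" for a :: 'a
      using principal_lsubgroup_convex by (rule bspec)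
    then show ?R by (intro martinez_if_principal allI)
  qed (rule ballI, rule martinez_convex_lsubgroup)
  have P: "(\<forall>a :: 'a. martinez (principal_lsubgroup UNIV a)) \<longleftrightarrow> martinez (UNIV :: 'a set)"
  proof
    assume "martinez (UNIV :: 'a set)"
    then show "\<forall>a :: 'a. martinez (principal_lsubgroup UNIV a)"
      by (intro allI martinez_convex_lsubgroup[OF _ principal_lsubgroup_convex])
  qed (rule martinez_if_principal)
  \<comment> \<open>Every entry is rewritten to the equality of principal subgroups with double
    polars, some by way of \<open>martinez UNIV\<close>. The intersection with \<open>G\<close> in
    the entry on minimal primes, which fixes the value of an empty intersection, disappears by
    \<open>Int_UNIV_left\<close>.\<close>
  show ?thesis
    unfolding assms all_equivalent_def ball_UNIV H P martinez_iff_Spec_d[symmetric]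
      distinct_closures_iff[OF refl] principal_d_element_iff
      disjunctive_iff_principal minimal_primes_dense_iff pi_base_iff
      martinez_iff_principal principal_iff_determined_by_polar[symmetric]
      perp_perp_eq_Inter_minimal_primes[symmetric] Int_UNIV_left
    by simp
qed

end
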